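(* Let $f:\mathbb{C}\to\mathbb{C}$ be a polynomial of degree $d>1$ with Julia set $J$, and let $\Gamma=(\mathcal V,\mathcal E)$ be a box chain model of $f$ on $J$. Let $\mathcal M$ be the minimum cycle multiplier over all simple cycles in the graph $\Gamma$. Then $\Gamma$ is box expansive (hence $f$ is hyperbolic) if and only if $\mathcal M>1$. That is, $\Gamma$ is box expansive if and only if $\mathcal M>1$, and in that case $f$ is hyperbolic.
   Context: The Julia set $J$ of a polynomial $f$ of degree $>1$ is the topological boundary of the set of points with bounded forward orbit. A closed box in $\mathbb{C}=\mathbb{R}^2$ is a set $[a,b]\times[c,d]$ with $a<b$, $c<d$. $\mathcal N(S,r)$ denotes the open $r$-neighborhood of $S$. Hyperbolic: $f$ is hyperbolic if there exist a riemannian metric $\mu$ on some neighborhood $U$ of $J$ and a constant $\lambda>1$ such that $|D_zf(\mathbf v)|_\mu\ge\lambda|\mathbf v|_\mu$ for every $z\in U$ and every $\mathbf v\in T_z\mathbb{C}$ (the inequality being understood at points where both sides are defined). Box chain model of $f$ on $J$: a directed graph $\Gamma=(\mathcal V,\mathcal E)$ (self-loops allowed) whose vertex set $\mathcal V=\{B_k\}_{k=1}^N$ is a finite collection of closed boxes with pairwise disjoint interiors and union containing $J$, such that for some $\delta>0$, $\mathcal E\supset\{(k,j): f(B_k)\cap\mathcal N(B_j,\delta)\ne\emptyset\}$, and such that $\Gamma$ is strongly connected. Here $(k,j)\in\mathcal E$ means there is an edge from $B_k$ to $B_j$. Multiplier of $B_k$: $\lambda_k=\min\{|f'(z)|:z\in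 B_k\}$. For an $n$-cycle of boxes $B_0\to\dots\to B_{n-1}\to B_n=B_0$ in $\Gamma$ ($n\ge1$), the cycle multiplier is $\lambda_0\cdots\lambda_{n-1}$. A cycle is simple if it is composed of distinct vertices $B_0,\dots,B_{n-1}$. Box metric: a family $\Phi=\{\varphi_k\}_{k=1}^N$ of positive constants (handicaps), one per box, inducing norms $|\mathbf v|_k=\varphi_k|\mathbf v|$ for $\mathbf v\in T_zB_k$ ($|\cdot|$ euclidean). $\Gamma$ is box expansive if there exist a box metric $\Phi$ and a constant $L>1$ with $|D_zf(\mathbf v)|_j\ge L|\mathbf v|_k$ for all $(k,j)\in\mathcal E$, $z\in B_k$, $\mathbf v\in T_zB_k$; equivalently $\varphi_j\lambda_k\ge L\varphi_k$ for all $(k,j)\in\mathcal E$. *)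

theory Defs
  imports
    "HOL-Analysis.Analysis"
    "Graph_Theory.Pair_Digraph"
    "Graph_Theory.Digraph_Component"
begin

definition julia_set :: "(complex \<Rightarrow> complex) \<Rightarrow> complex set" where
  "julia_set f = frontier {z. bounded (range (\<lambda>n. (f ^^ n) z))}"


section \<open>Hyperbolicity\<close>

text \<open>\<open>Ck_on k F U\<close>, for \<open>U\<close> open: all iterated partial derivatives of \<open>F\<close> of order at most
  \<open>k\<close> exist, and are continuous, on \<open>U\<close>.\<close>

primrec Ck_on :: "nat \<Rightarrow> ('a::real_normed_vector \<Rightarrow> 'b::real_normed_vector) \<Rightarrow> 'a set \<Rightarrow> bool" where
  "Ck_on 0 F U \<longleftrightarrow> continuous_on U F"
| "Ck_on (Suc k) F U \<longleftrightarrow>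
     (\<forall>x\<in>U. F differentiable (at x)) \<and>
     (\<forall>v. Ck_on k (\<lambda>x. frechet_derivative F (at x) v) U)"

definition smooth_on :: "('a::real_normed_vector \<Rightarrow> 'b::real_normed_vector) \<Rightarrow> 'a set \<Rightarrow> bool" where
  "smooth_on F U \<longleftrightarrow> (\<forall>k. Ck_on k F U)"

text \<open>\<open>\<mu> z\<close> is the inner product on the tangent space at \<open>z\<close>, which is identified with the
  real vector space \<open>\<complex>\<close>.\<close>

definition riemannian_metric_on ::
    "complex set \<Rightarrow> (complex \<Rightarrow> complex \<Rightarrow> complex \<Rightarrow> real) \<Rightarrow> bool" where
  "riemannian_metric_on U \<mu> \<longleftrightarrow>
     (\<forall>z\<in>U. bilinear (\<mu> z) \<and>
             (\<forall>v w. \<mu> z v w = \<mu> z w v) \<and>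
             (\<forall>v. v \<noteq> 0 \<longrightarrow> \<mu> z v v > 0)) \<and>
     (\<forall>v w. smooth_on (\<lambda>z. \<mu> z v w) U)"

definition riemannian_norm ::
    "(complex \<Rightarrow> complex \<Rightarrow> complex \<Rightarrow> real) \<Rightarrow> complex \<Rightarrow> complex \<Rightarrow> real" where
  "riemannian_norm \<mu> z v = sqrt (\<mu> z v v)"

text \<open>The expansion inequality compares norms at \<open>z\<close> and at \<open>f z\<close>, so it is required when both
  points lie in the domain \<open>U\<close> of the metric.\<close>

definition hyperbolic :: "(complex \<Rightarrow> complex) \<Rightarrow> bool" where
  "hyperbolic f \<longleftrightarrow>
     (\<exists>U \<mu> \<Lambda>. open U \<and> julia_set f \<subseteq> U \<and> riemannian_metric_on U \<mu> \<and> \<Lambda> > 1 \<and>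
        (\<forall>z v. z \<in> U \<and> f z \<in> U \<longrightarrow>
           riemannian_norm \<mu> (f z) (frechet_derivative f (at z) v) \<ge> \<Lambda> * riemannian_norm \<mu> z v))"


section \<open>Box chain models\<close>

definition closed_box :: "complex set \<Rightarrow> bool" where
  "closed_box B \<longleftrightarrow>
     (\<exists>a b c d. a < b \<and> c < d \<and> B = {z. Re z \<in> {a..b} \<and> Im z \<in> {c..d}})"

definition nbhd :: "complex set \<Rightarrow> real \<Rightarrow> complex set" where
  "nbhd S r = (\<Union>s\<in>S. ball s r)"

text \<open>The vertices are the boxes themselves, so that \<open>(B, C) \<in> parcs G\<close> is an edge from the
  box \<open>B\<close> to the box \<open>C\<close>.\<close>

definition box_chain_model :: "(complex \<Rightarrow> complex) \<Rightarrow> complex set pair_pre_digraph \<Rightarrow> bool" where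
  "box_chain_model f G \<longleftrightarrow>
     pair_fin_digraph G \<and>
     (\<forall>B\<in>pverts G. closed_box B) \<and>
     (\<forall>B\<in>pverts G. \<forall>C\<in>pverts G. B \<noteq> C \<longrightarrow> interior B \<inter> interior C = {}) \<and>
     julia_set f \<subseteq> \<Union>(pverts G) \<and>
     (\<exists>\<delta>>0. {(B, C). B \<in> pverts G \<and> C \<in> pverts G \<and> f ` B \<inter> nbhd C \<delta> \<noteq> {}} \<subseteq> parcs G) \<and>
     strongly_connected (with_proj G)"

text \<open>A continuous function attains its infimum on a box, so for polynomial \<open>f\<close> this is a
  minimum.\<close>

definition box_multiplier :: "(complex \<Rightarrow> complex) \<Rightarrow> complex set \<Rightarrow> real" where
  "box_multiplier f B = (INF z\<in>B. cmod (deriv f z))"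

text \<open>The cycle \<open>B\<^sub>0 \<rightarrow> \<dots> \<rightarrow> B\<^sub>n = B\<^sub>0\<close> is represented by its list of arcs
  \<open>[(B\<^sub>0, B\<^sub>1), \<dots>, (B\<^bsub>n-1\<^esub>, B\<^sub>n)]\<close>.\<close>

definition cycle_multiplier ::
    "(complex \<Rightarrow> complex) \<Rightarrow> (complex set \<times> complex set) list \<Rightarrow> real" where
  "cycle_multiplier f p = (\<Prod>e\<leftarrow>p. box_multiplier f (fst e))"

text \<open>\<^const>\<open>pre_digraph.cycle\<close> requires the vertices \<open>B\<^sub>1, \<dots>, B\<^sub>n\<close> to be distinct and
  \<open>n \<ge> 1\<close>; it thus describes exactly the simple cycles, loops included. A finite digraph has only
  finitely many of them.\<close>

definition min_cycle_multiplier ::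
    "(complex \<Rightarrow> complex) \<Rightarrow> complex set pair_pre_digraph \<Rightarrow> real" where
  "min_cycle_multiplier f G = Min (cycle_multiplier f ` {p. pre_digraph.cycle (with_proj G) p})"

definition box_expansive :: "(complex \<Rightarrow> complex) \<Rightarrow> complex set pair_pre_digraph \<Rightarrow> bool" where
  "box_expansive f G \<longleftrightarrow>
     (\<exists>\<phi> L. (\<forall>B\<in>pverts G. \<phi> B > 0) \<and> L > 1 \<and>
        (\<forall>(B, C)\<in>parcs G. \<forall>z\<in>B. \<forall>v.
           \<phi> C * cmod (frechet_derivative f (at z) v) \<ge> L * (\<phi> B * cmod v)))"

end

theory Submission
  imports Defs "HOL-Computational_Algebra.Fundamental_Theorem_Algebra"
begin

text \<open>Along a cycle the handicaps telescope, so box expansion by \<open>L\<close> forces every cycle multiplier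
  to be at least \<open>L > 1\<close>. Conversely, if \<open>\<M> > 1\<close> and there are \<open>N\<close> arcs, then with \<open>L\<^sup>N = \<M>\<close> the
  arc weights \<open>\<lambda>\<^sub>k / L\<close> have product at least 1 along every simple cycle, so that the least weight
  of a simple path starting at a box is a handicap for it. Cycles exist because \<open>J\<close> is nonempty and
  forward invariant.

  For hyperbolicity, the handicaps are blended near \<open>J\<close> by a weighted mean over the boxes close to
  a point. The result is a continuous conformal factor that is still expanded, because the arcs of
  a box chain model tolerate an error \<open>\<delta>\<close>. A polynomial approximation of it (Stone-Weierstrass) is
  smooth and keeps the strict expansion.\<close>

section \<open>Potentials on finite digraphs\<close>

text \<open>\<open>cycle\<close> asks for distinctness of all visited vertices but the first; for
  \<open>e # q\<close> these are exactly the vertices of the simple path \<open>q\<close>.\<close>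

lemma (in wf_digraph) cycle_Cons_apath:
  assumes "e \<in> arcs G" "apath (head G e) q (tail G e)"
  shows "cycle (e # q)"
  using assms unfolding cycle_def apath_def
  by (intro exI[of _ "tail G e"]) (auto simp: awalk_Cons_iff)

text \<open>Used twice: it shows that the set of cycles under the minimum is nonempty, and that no
  arc weight can vanish when all cycle products exceed 1.\<close>

lemma (in wf_digraph) strongly_connected_arc_on_cycle:
  assumes "strongly_connected G" "e \<in> arcs G"
  obtains q where "cycle (e # q)"
proof -
  have "head G e \<rightarrow>\<^sup>*\<^bsub>G\<^esub> tail G e"
    using assms by (auto simp: strongly_connected_def)
  then obtain q where "apath (head G e) q (tail G e)"
    using reachable_apath by blast
  then show ?thesis using cycle_Cons_apath assms(2) that by blast
qed

lemma (in fin_digraph) finite_cycles: "finite {p. cycle p}"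
proof (rule finite_subset)
  show "{p. cycle p} \<subseteq> {p. set p \<subseteq> arcs G \<and> distinct p}"
    by (auto simp: cycle_conv)
  show "finite {p. set p \<subseteq> arcs G \<and> distinct p}"
    by (rule finite_subset_distinct) simp
qed

lemma (in fin_digraph) finite_apaths_from: "finite {p. \<exists>v. apath u p v}"
proof (rule finite_subset)
  show "{p. \<exists>v. apath u p v} \<subseteq> {p. set p \<subseteq> arcs G \<and> distinct p}"
    by (auto simp: apath_def intro: distinct_verts_imp_distinct)
  show "finite {p. set p \<subseteq> arcs G \<and> distinct p}"
    by (rule finite_subset_distinct) simp
qed

lemma prod_list_map_pos:
  fixes w :: "'a \<Rightarrow> real"
  assumes "\<And>x. x \<in> set xs \<Longrightarrow> w x > 0"
  shows "prod_list (map w xs) > 0"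
  using assms by (induction xs) auto

text \<open>The potential of a vertex is the least weight of a simple path starting there. When an arc
  prepended to an optimal path closes a cycle, dropping the cycle does not increase the weight.\<close>

lemma (in fin_digraph) multiplicative_potential:
  fixes w :: "'b \<Rightarrow> real"
  assumes pos: "\<And>e. e \<in> arcs G \<Longrightarrow> w e > 0"
    and cyc: "\<And>p. cycle p \<Longrightarrow> prod_list (map w p) \<ge> 1"
  obtains \<phi> where "\<And>v. v \<in> verts G \<Longrightarrow> \<phi> v > 0"
    and "\<And>e. e \<in> arcs G \<Longrightarrow> \<phi> (tail G e) \<le> w e * \<phi> (head G e)"
proof
  define W where "W p = prod_list (map w p)" for p
  define A where "A u = {p. \<exists>v. apath u p v}" for u
  define \<phi> where "\<phi> u = Min (W ` A u)" for u
  have fin: "finite (A u)" for u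
    unfolding A_def by (rule finite_apaths_from)
  \<comment> \<open>The empty path at \<open>u\<close> is simple.\<close>
  have ne: "A u \<noteq> {}" if "u \<in> verts G" for u
    using that apath_Nil_iff[of u u] by (auto simp: A_def)
  have Wpos: "W p > 0" if "set p \<subseteq> arcs G" for p
    unfolding W_def by (rule prod_list_map_pos) (use that pos in auto)
  have att: "\<exists>p\<in>A u. \<phi> u = W p" if "u \<in> verts G" for u
  proof -
    have "Min (W ` A u) \<in> W ` A u" using fin ne[OF that] by (intro Min_in) auto
    then show ?thesis by (auto simp: \<phi>_def)
  qed
  have le: "\<phi> u \<le> W p" if "p \<in> A u" for u p
    unfolding \<phi>_def using fin that by (intro Min_le) auto
  show "\<phi> v > 0" if v: "v \<in> verts G" for v
  proof -
    obtain p where p: "p \<in> A v" "\<phi> v = W p" using att[OF v] by blast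
    then have "set p \<subseteq> arcs G" by (auto simp: A_def apath_def)
    then show ?thesis using p Wpos by simp
  qed
  show "\<phi> (tail G e) \<le> w e * \<phi> (head G e)" if e: "e \<in> arcs G" for e
  proof -
    obtain p where p: "p \<in> A (head G e)" "\<phi> (head G e) = W p"
      using att[of "head G e"] e by auto
    then obtain v where v: "apath (head G e) p v" by (auto simp: A_def)
    have W: "W (e # p) = w e * \<phi> (head G e)" by (simp add: W_def p(2))
    show ?thesis
    proof (cases "tail G e \<in> set (awalk_verts (head G e) p)")
      case False
      then have "e # p \<in> A (tail G e)"
        using v e by (auto simp: A_def apath_Cons_iff)
      then show ?thesis using le W by metis
    next
      case True
      \<comment> \<open>The arc \<open>e\<close> closes \<open>q\<close> into a simple cycle, while
        \<open>r\<close> competes in the minimum that defines the potential at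
        \<open>tail G e\<close>.\<close>
      then obtain q r where qr: "p = q @ r" "awalk (head G e) q (tail G e)" "awalk (tail G e) r v"
        using awalk_decomp v by (meson apath_def)
      have "awlast (head G e) q = tail G e" using qr(2) by auto
      then have ap: "apath (head G e) q (tail G e)" "apath (tail G e) r v"
        using v unfolding qr(1) apath_append_iff by auto
      have "1 \<le> W (e # q)"
        unfolding W_def by (rule cyc, rule cycle_Cons_apath) (use e ap in auto)
      moreover have "0 < W r" using qr(3) by (intro Wpos) auto
      ultimately have "W r \<le> W (e # q) * W r" by simp
      also have "\<dots> = w e * \<phi> (head G e)" using W by (simp add: W_def qr(1))
      finally show ?thesis using le[of r "tail G e"] ap(2) unfolding A_def by fastforce
    qed
  qed
qed

lemma (in fin_digraph) cycle_length_le: "cycle p \<Longrightarrow> length p \<le> card (arcs G)"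
  by (metis (no_types, lifting) awalkE' card_mono cycle_conv distinct_card finite_arcs)

lemma prod_list_map_divide:
  fixes f :: "'a \<Rightarrow> real"
  shows "prod_list (map (\<lambda>x. f x / c) xs) = prod_list (map f xs) / c ^ length xs"
  by (induction xs) auto

text \<open>A simple cycle has at most \<open>N\<close> arcs, so dividing every weight by
  \<open>L\<close> costs its product at most the factor \<open>L ^ N = M\<close>. The rescaled
  weights then satisfy the hypothesis of \<open>multiplicative_potential\<close>.\<close>

lemma (in fin_digraph) expanding_potential:
  fixes w :: "'b \<Rightarrow> real"
  assumes nonneg: "\<And>e. e \<in> arcs G \<Longrightarrow> w e \<ge> 0"
    and sc: "strongly_connected G" and ne: "arcs G \<noteq> {}"
    and cyc: "\<And>p. cycle p \<Longrightarrow> prod_list (map w p) \<ge> M" and M: "M > 1"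
  obtains \<phi> L where "\<And>v. v \<in> verts G \<Longrightarrow> \<phi> v > 0" "L > 1"
    and "\<And>e. e \<in> arcs G \<Longrightarrow> L * \<phi> (tail G e) \<le> w e * \<phi> (head G e)"
proof -
  define N where "N = card (arcs G)"
  have N: "N > 0" using ne by (simp add: N_def card_gt_0_iff)
  define L where "L = root N M"
  have L: "L > 1" "L ^ N = M" using N M by (auto simp: L_def)
  \<comment> \<open>A zero weight would annihilate the product along a cycle through
    \<open>e\<close>, which is at least \<open>M > 1\<close>.\<close>
  have pos: "w e / L > 0" if e: "e \<in> arcs G" for e
  proof -
    obtain q where "cycle (e # q)" using strongly_connected_arc_on_cycle[OF sc e] .
    from cyc[OF this] M have "w e \<noteq> 0" by auto
    then show ?thesis using nonneg[OF e] L by simp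
  qed
  have "prod_list (map (\<lambda>e. w e / L) p) \<ge> 1" if p: "cycle p" for p
  proof -
    have "L ^ length p \<le> L ^ N"
      using cycle_length_le[OF p] L(1) by (intro power_increasing) (auto simp: N_def)
    with cyc[OF p] L show ?thesis by (simp add: prod_list_map_divide)
  qed
  from multiplicative_potential[OF pos this] obtain \<phi> where
    \<phi>: "\<And>v. v \<in> verts G \<Longrightarrow> \<phi> v > 0"
      "\<And>e. e \<in> arcs G \<Longrightarrow> \<phi> (tail G e) \<le> w e / L * \<phi> (head G e)"
    by blast
  show ?thesis
    by (rule that[of \<phi> L]) (use \<phi> L in \<open>auto simp: field_simps\<close>)
qed

text \<open>Multiplying the arc inequalities along the walk cancels the intermediate potentials. On
  a closed walk the two remaining ones cancel as well.\<close>

lemma (in wf_digraph) prod_list_awalk_potential: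
  fixes w :: "'b \<Rightarrow> real"
  assumes "awalk u p v" "L > 0"
    and pos: "\<And>v. v \<in> verts G \<Longrightarrow> \<phi> v > 0"
    and arc: "\<And>e. e \<in> arcs G \<Longrightarrow> L * \<phi> (tail G e) \<le> w e * \<phi> (head G e)"
  shows "L ^ length p * \<phi> u \<le> prod_list (map w p) * \<phi> v"
  using assms(1)
proof (induction p arbitrary: u)
  case Nil
  then show ?case by (simp add: awalk_Nil_iff)
next
  case (Cons e p)
  then have e: "e \<in> arcs G" "u = tail G e" "awalk (head G e) p v"
    by (auto simp: awalk_Cons_iff)
  \<comment> \<open>The sign of \<open>w e\<close> is read off from the arc inequality, since the
    potentials are positive.\<close>
  have "0 \<le> L * \<phi> (tail G e)" using pos[of "tail G e"] e \<open>L > 0\<close> by simp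
  then have "0 \<le> w e * \<phi> (head G e)" using arc[OF e(1)] by linarith
  then have w: "w e \<ge> 0" using pos[of "head G e"] e(1) by (simp add: zero_le_mult_iff)
  have "L ^ length (e # p) * \<phi> u \<le> L ^ length p * (w e * \<phi> (head G e))"
    using arc[OF e(1)] \<open>L > 0\<close> by (simp add: e(2) mult.assoc mult_left_mono mult.left_commute)
  also have "\<dots> = w e * (L ^ length p * \<phi> (head G e))" by simp
  also have "\<dots> \<le> w e * (prod_list (map w p) * \<phi> v)"
    using Cons.IH[OF e(3)] w by (rule mult_left_mono)
  finally show ?case by simp
qed

section \<open>The Julia set of a polynomial\<close>

text \<open>Write the polynomial as \<open>a + z * q z\<close> with \<open>q\<close> nonconstant.
  Far out \<open>q\<close> has modulus at least 3, and one of the three copies of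
  \<open>cmod z\<close> pays for \<open>a\<close>.\<close>

lemma poly_escape_radius:
  fixes p :: "complex poly"
  assumes "degree p > 1"
  obtains R where "R > 0" "\<And>z. cmod z \<ge> R \<Longrightarrow> cmod (poly p z) \<ge> 2 * cmod z"
proof -
  obtain a q where p: "p = pCons a q" by (cases p)
  obtain b r where q: "q = pCons b r" by (cases q)
  have "r \<noteq> 0" using assms by (auto simp: p q split: if_splits)
  from poly_infinity[OF this, of 3 b] obtain R0 where
    R0: "\<And>z. R0 \<le> norm z \<Longrightarrow> 3 \<le> cmod (poly q z)" unfolding q by blast
  show ?thesis
  proof
    show "max 1 (max R0 (cmod a)) > 0" by simp
    fix z assume z: "cmod z \<ge> max 1 (max R0 (cmod a))"
    have "cmod z * 3 \<le> cmod z * cmod (poly q z)"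
      using R0[of z] z by (intro mult_left_mono) auto
    also have "\<dots> = cmod (poly p z - a)" by (simp add: p norm_mult)
    also have "\<dots> \<le> cmod (poly p z) + cmod a" by (rule norm_triangle_ineq4)
    finally show "cmod (poly p z) \<ge> 2 * cmod z" using z by simp
  qed
qed

text \<open>In the connected plane only the empty set and the whole plane have empty frontier. The
  set \<open>K\<close> is neither: the point \<open>R\<close> escapes, and a fixed point has a
  bounded orbit.\<close>

lemma julia_set_poly_nonempty:
  fixes p :: "complex poly"
  assumes "degree p > 1"
  shows "julia_set (poly p) \<noteq> {}"
proof -
  define K where "K = {z. bounded (range (\<lambda>n. (poly p ^^ n) z))}"
  obtain R where R: "R > 0" "\<And>z. cmod z \<ge> R \<Longrightarrow> cmod (poly p z) \<ge> 2 * cmod z"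
    by (rule poly_escape_radius[OF assms]) blast
  have grow: "cmod ((poly p ^^ n) (of_real R)) \<ge> 2 ^ n * R" for n
  proof (induction n)
    case (Suc n)
    have "R \<le> 2 ^ n * R" using R(1) by simp
    with Suc have "R \<le> cmod ((poly p ^^ n) (of_real R))" by linarith
    from R(2)[OF this] Suc show ?case by simp
  qed (use R in simp)
  have "complex_of_real R \<notin> K"
  proof
    assume "complex_of_real R \<in> K"
    then obtain b where b: "\<And>n. cmod ((poly p ^^ n) (of_real R)) \<le> b"
      by (auto simp: K_def bounded_iff)
    obtain n where "b / R < 2 ^ n" using real_arch_pow[of 2 "b / R"] by auto
    then have "b < 2 ^ n * R" using R(1) by (simp add: field_simps)
    with b[of n] grow[of n] show False by linarith
  qed
  then have "K \<noteq> UNIV" by blast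
  moreover have "K \<noteq> {}"
  proof -
    \<comment> \<open>Zeros of this difference are the fixed points of \<open>poly p\<close>; its
      degree stays above 1, so it is not constant.\<close>
    have "degree (p - [:0, 1:]) = degree p"
      using assms degree_add_eq_left[of "- [:0, 1:]" p] by (simp del: minus_pCons)
    then have "\<not> constant (poly (p - [:0, 1:]))"
      using assms constant_degree[of "p - [:0, 1:]"] by simp
    from fundamental_theorem_of_algebra[OF this] obtain z where "poly p z = z" by auto
    then have "(poly p ^^ n) z = z" for n by (induction n) auto
    then have "z \<in> K" by (simp add: K_def)
    then show ?thesis by blast
  qed
  ultimately show ?thesis
    unfolding julia_set_def K_def[symmetric] by (simp add: frontier_eq_empty)
qed

lemma bounded_orbit_iff:
  "bounded (range (\<lambda>n. (f ^^ n) (f z))) \<longleftrightarrow> bounded (range (\<lambda>n. (f ^^ n) z))"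
proof -
  have "range (\<lambda>n. (f ^^ n) z) = insert z (range (\<lambda>n. (f ^^ n) (f z)))"
  proof -
    have "(f ^^ n) z \<in> insert z (range (\<lambda>n. (f ^^ n) (f z)))" for n
      by (cases n) (auto simp: funpow_swap1)
    moreover have "z = (f ^^ 0) z" "(f ^^ n) (f z) = (f ^^ Suc n) z" for n
      by (auto simp: funpow_swap1)
    ultimately show ?thesis by blast
  qed
  then show ?thesis by simp
qed

text \<open>A point lies in \<open>K\<close> exactly if its image does. Continuity carries this over
  to the closure; and the preimage of the interior is an open subset of \<open>K\<close>, hence in
  the interior, so no frontier point is mapped into the interior.\<close>

lemma julia_set_invariant:
  assumes cont: "continuous_on UNIV f" and z: "z \<in> julia_set f"
  shows "f z \<in> julia_set f"
proof -
  define K where "K = {z. bounded (range (\<lambda>n. (f ^^ n) z))}"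
  have K: "f z \<in> K \<longleftrightarrow> z \<in> K" for z by (simp add: K_def bounded_orbit_iff)
  have J: "julia_set f = closure K - interior K"
    by (simp add: julia_set_def K_def frontier_def)
  have "f ` closure K \<subseteq> closure K"
    by (rule image_closure_subset) (use cont K closure_subset in \<open>auto intro: continuous_on_subset\<close>)
  moreover have "f z \<notin> interior K"
  proof
    assume fz: "f z \<in> interior K"
    have "open (f -` interior K)" using cont by (simp add: open_vimage)
    moreover have "f -` interior K \<subseteq> K" using K interior_subset by blast
    ultimately have "f -` interior K \<subseteq> interior K" by (simp add: interior_maximal)
    with fz z show False by (auto simp: J)
  qed
  ultimately show ?thesis using z by (auto simp: J)
qed

section \<open>Polynomial functions are smooth\<close>

text \<open>Directional derivatives stay within the polynomial functions, which is what the
  induction on the order of differentiability needs.\<close>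

lemma real_polynomial_function_has_derivative:
  assumes "real_polynomial_function g"
  obtains D where "\<And>x. (g has_derivative D x) (at x)"
    and "\<And>v. real_polynomial_function (\<lambda>x. D x v)"
proof -
  have "\<exists>D. (\<forall>x. (g has_derivative D x) (at x)) \<and> (\<forall>v. real_polynomial_function (\<lambda>x. D x v))"
    using assms
  proof induction
    case (linear f)
    then show ?case
      by (intro exI[of _ "\<lambda>x. f"]) (auto intro: bounded_linear_imp_has_derivative)
  next
    case (const c)
    then show ?case by (intro exI[of _ "\<lambda>x v. 0"]) auto
  next
    case (add f g)
    then obtain D E where "\<forall>x. (f has_derivative D x) (at x)" "\<forall>x. (g has_derivative E x) (at x)"
      "\<forall>v. real_polynomial_function (\<lambda>x. D x v)" "\<forall>v. real_polynomial_function (\<lambda>x. E x v)"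
      by auto
    then show ?case
      by (intro exI[of _ "\<lambda>x v. D x v + E x v"]) (auto intro!: has_derivative_add)
  next
    case (mult f g)
    then obtain D E where "\<forall>x. (f has_derivative D x) (at x)" "\<forall>x. (g has_derivative E x) (at x)"
      "\<forall>v. real_polynomial_function (\<lambda>x. D x v)" "\<forall>v. real_polynomial_function (\<lambda>x. E x v)"
      by auto
    note DE = this
    have "real_polynomial_function (\<lambda>x. f x * E x v + D x v * g x)" for v
      by (intro real_polynomial_function.intros(3,4)) (use mult.hyps DE in auto)
    then show ?case
      using DE by (intro exI[of _ "\<lambda>x v. f x * E x v + D x v * g x"]) (auto intro!: has_derivative_mult)
  qed
  then show ?thesis using that by blast
qed

lemma real_polynomial_function_smooth_on:
  assumes "real_polynomial_function g"
  shows "smooth_on g U"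
proof -
  have "Ck_on k g U" for k
    using assms
  proof (induction k arbitrary: g)
    case 0
    obtain D where "\<And>x. (g has_derivative D x) (at x)"
      using real_polynomial_function_has_derivative[OF 0] by blast
    then show ?case
      by (auto intro!: continuous_at_imp_continuous_on has_derivative_continuous)
  next
    case (Suc k)
    obtain D where D: "\<And>x. (g has_derivative D x) (at x)"
      "\<And>v. real_polynomial_function (\<lambda>x. D x v)"
      using real_polynomial_function_has_derivative[OF Suc.prems] by blast
    then have "frechet_derivative g (at x) = D x" for x
      by (metis frechet_derivative_at)
    then show ?case using D Suc.IH by (auto simp: differentiable_def)
  qed
  then show ?thesis by (simp add: smooth_on_def)
qed

section \<open>Smoothing a box metric\<close>

text \<open>The bound on \<open>a i\<close> is asked for only where the weight is positive; later
  this restricts attention to the boxes close to a given point.\<close>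

lemma weighted_mean_ge:
  fixes a \<rho> :: "'a \<Rightarrow> real"
  assumes "\<And>i. i \<in> I \<Longrightarrow> \<rho> i \<ge> 0" "sum \<rho> I > 0"
    and "\<And>i. i \<in> I \<Longrightarrow> \<rho> i > 0 \<Longrightarrow> c \<le> a i"
  shows "c \<le> (\<Sum>i\<in>I. a i * \<rho> i) / sum \<rho> I"
proof -
  have "c * \<rho> i \<le> a i * \<rho> i" if "i \<in> I" for i
    using assms(1,3)[OF that] by (cases "\<rho> i = 0") (auto intro: mult_right_mono)
  then have "c * sum \<rho> I \<le> (\<Sum>i\<in>I. a i * \<rho> i)"
    unfolding sum_distrib_left by (rule sum_mono)
  then show ?thesis using assms(2) by (simp add: pos_le_divide_eq)
qed

lemma weighted_mean_le:
  fixes a \<rho> :: "'a \<Rightarrow> real"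
  assumes "\<And>i. i \<in> I \<Longrightarrow> \<rho> i \<ge> 0" "sum \<rho> I > 0"
    and "\<And>i. i \<in> I \<Longrightarrow> \<rho> i > 0 \<Longrightarrow> a i \<le> c"
  shows "(\<Sum>i\<in>I. a i * \<rho> i) / sum \<rho> I \<le> c"
  using weighted_mean_ge[of I \<rho> "-c" "\<lambda>i. - a i"] assms by (simp add: sum_negf)

text \<open>Replace \<open>z\<close> by a nearest point \<open>z'\<close> of \<open>B\<close>.
  Uniform continuity keeps \<open>f z'\<close> within \<delta> of \<open>C\<close>, so the assumed
  expansion applies at \<open>z'\<close>; going back to \<open>z\<close> changes the derivative
  slightly and lowers \<open>L\<close> only to its midpoint with 1.\<close>

lemma expansion_near_boxes:
  fixes V :: "complex set set" and f f' :: "complex \<Rightarrow> complex"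
  assumes V: "finite V" "V \<noteq> {}" "\<And>B. B \<in> V \<Longrightarrow> compact B \<and> B \<noteq> {}"
    and cont: "continuous_on UNIV f" "continuous_on UNIV f'"
    and \<phi>: "\<And>B. B \<in> V \<Longrightarrow> \<phi> B > 0" and L: "L > 1" and \<delta>: "\<delta> > 0"
    and exp: "\<And>B C z. \<lbrakk>B \<in> V; C \<in> V; f ` B \<inter> nbhd C \<delta> \<noteq> {}; z \<in> B\<rbrakk>
      \<Longrightarrow> \<phi> C * cmod (f' z) \<ge> L * \<phi> B"
  obtains \<epsilon> where "\<epsilon> > 0"
    and "\<And>B C z. \<lbrakk>B \<in> V; C \<in> V; infdist z B < \<epsilon>; infdist (f z) C < \<epsilon>\<rbrakk>
      \<Longrightarrow> \<phi> C * cmod (f' z) \<ge> (L + 1) / 2 * \<phi> B"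
proof -
  \<comment> \<open>A compact set for uniform continuity; as \<epsilon> will be at most 1, it
    contains both \<open>z\<close> and \<open>z'\<close>.\<close>
  define K where "K = {z. infdist z (\<Union>V) \<le> 1}"
  have VS: "\<Union>V \<noteq> {}" using V by blast
  have "compact K"
    unfolding K_def using V VS by (intro compact_infdist_le) (auto intro: compact_Union)
  then have uc: "uniformly_continuous_on K f" "uniformly_continuous_on K f'"
    using cont by (auto intro!: compact_uniformly_continuous intro: continuous_on_subset)
  define m M where "m = Min (\<phi> ` V)" and "M = Max (\<phi> ` V)"
  have mM: "m \<le> \<phi> B" "\<phi> B \<le> M" if "B \<in> V" for B
    using that V(1) by (auto simp: m_def M_def)
  have m: "m > 0" using V(1,2) \<phi> by (simp add: m_def)
  have M: "M > 0" using V(2) mM(2) \<phi> by (meson ex_in_conv less_le_trans)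
  \<comment> \<open>Chosen so that the error \<open>M * \<eta>\<close> equals
    \<open>(L - 1) / 2 * m\<close>, which is at most \<open>(L - 1) / 2\<close> times any
    handicap.\<close>
  define \<eta> where "\<eta> = (L - 1) / 2 * (m / M)"
  have \<eta>: "\<eta> > 0" using m M L by (simp add: \<eta>_def)
  obtain d1 where d1: "d1 > 0"
    "\<And>x y. x \<in> K \<Longrightarrow> y \<in> K \<Longrightarrow> dist y x < d1 \<Longrightarrow> dist (f y) (f x) < \<delta> / 2"
    using uc(1) \<delta> unfolding uniformly_continuous_on_def by (meson half_gt_zero)
  obtain d2 where d2: "d2 > 0"
    "\<And>x y. x \<in> K \<Longrightarrow> y \<in> K \<Longrightarrow> dist y x < d2 \<Longrightarrow> dist (f' y) (f' x) < \<eta>"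
    using uc(2) \<eta> unfolding uniformly_continuous_on_def by meson
  define \<epsilon> where "\<epsilon> = min (min 1 (\<delta> / 2)) (min d1 d2)"
  show ?thesis
  proof
    show "\<epsilon> > 0" using d1 d2 \<delta> by (simp add: \<epsilon>_def)
  next
    fix B C z
    assume BC: "B \<in> V" "C \<in> V" and near: "infdist z B < \<epsilon>" "infdist (f z) C < \<epsilon>"
    obtain z' where z': "z' \<in> B" "dist z z' < \<epsilon>"
      using infdist_attains_inf[of B z] V(3)[OF BC(1)] near(1) by (metis compact_imp_closed)
    obtain c where c: "c \<in> C" "dist (f z) c < \<epsilon>"
      using infdist_attains_inf[of C "f z"] V(3)[OF BC(2)] near(2) by (metis compact_imp_closed)
    have "z' \<in> \<Union>V" using z' BC by blast
    then have "infdist z (\<Union>V) \<le> dist z z'" "infdist z' (\<Union>V) = 0"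
      by (auto intro: infdist_le)
    then have K: "z \<in> K" "z' \<in> K" using z' by (auto simp: K_def \<epsilon>_def)
    have "dist (f z) (f z') < \<delta> / 2" "dist (f' z') (f' z) < \<eta>"
      using d1(2)[OF K(2,1)] d2(2)[OF K] z'(2) by (auto simp: \<epsilon>_def dist_commute)
    note near' = this
    have "dist c (f z') \<le> dist (f z) c + dist (f z) (f z')"
      by (metis dist_commute dist_triangle)
    also have "\<dots> < \<delta>" using near'(1) c(2) by (simp add: \<epsilon>_def)
    finally have "f z' \<in> f ` B \<inter> nbhd C \<delta>" using c(1) z'(1) by (auto simp: nbhd_def)
    then have "L * \<phi> B \<le> \<phi> C * cmod (f' z')" using exp[OF BC _ z'(1)] by blast
    also have "\<dots> \<le> \<phi> C * (cmod (f' z) + \<eta>)"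
    proof (rule mult_left_mono)
      show "cmod (f' z') \<le> cmod (f' z) + \<eta>"
        using near'(2) norm_triangle_sub[of "f' z'" "f' z"] by (simp add: dist_norm)
    qed (use \<phi>[OF BC(2)] in simp)
    also have "\<dots> \<le> \<phi> C * cmod (f' z) + M * \<eta>"
      using mM(2)[OF BC(2)] \<eta> by (simp add: distrib_left mult_right_mono)
    also have "M * \<eta> = (L - 1) / 2 * m" using M by (simp add: \<eta>_def)
    also have "\<dots> \<le> (L - 1) / 2 * \<phi> B" using mM(1)[OF BC(1)] L by (intro mult_left_mono) auto
    finally show "\<phi> C * cmod (f' z) \<ge> (L + 1) / 2 * \<phi> B" by (simp add: field_simps)
  qed
qed

text \<open>Handicaps jump where boxes meet; averaging over all boxes closer than \<epsilon> removes
  the jumps. Every pair of boxes with positive weights at \<open>z\<close> and at \<open>f z\<close>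
  satisfies the expansion inequality, so the two means satisfy it too.\<close>

lemma smooth_expanding_conformal_factor:
  fixes V :: "complex set set" and f f' :: "complex \<Rightarrow> complex"
  assumes V: "finite V" "V \<noteq> {}" "\<And>B. B \<in> V \<Longrightarrow> compact B \<and> B \<noteq> {}"
    and cont: "continuous_on UNIV f" "continuous_on UNIV f'"
    and \<phi>: "\<And>B. B \<in> V \<Longrightarrow> \<phi> B > 0" and L: "L > 1" and \<delta>: "\<delta> > 0"
    and exp: "\<And>B C z. \<lbrakk>B \<in> V; C \<in> V; f ` B \<inter> nbhd C \<delta> \<noteq> {}; z \<in> B\<rbrakk>
      \<Longrightarrow> \<phi> C * cmod (f' z) \<ge> L * \<phi> B"
  obtains U g \<Lambda> where "open U" "\<Union>V \<subseteq> U" "real_polynomial_function g" "\<And>z. z \<in> U \<Longrightarrow> g z > 0"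
    "\<Lambda> > 1" "\<And>z. z \<in> U \<Longrightarrow> f z \<in> U \<Longrightarrow> g (f z) * cmod (f' z) \<ge> \<Lambda> * g z"
proof -
  obtain \<epsilon> where \<epsilon>: "\<epsilon> > 0" and near: "\<And>B C z. \<lbrakk>B \<in> V; C \<in> V; infdist z B < \<epsilon>; infdist (f z) C < \<epsilon>\<rbrakk>
      \<Longrightarrow> \<phi> C * cmod (f' z) \<ge> (L + 1) / 2 * \<phi> B"
    by (rule expansion_near_boxes[where \<phi> = \<phi>, OF assms]) blast+
  \<comment> \<open>A continuous weight that is positive exactly when the box is closer than
    \<epsilon>.\<close>
  define \<rho> where "\<rho> z B = max 0 (\<epsilon> - infdist z B)" for z :: complex and B
  define \<psi> where "\<psi> z = (\<Sum>B\<in>V. \<phi> B * \<rho> z B) / sum (\<rho> z) V" for z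
  \<comment> \<open>With radius \<open>\<epsilon> / 2\<close> each point of \<open>K\<close> has a
    box closer than \<epsilon>, so the total weight in the denominator of \<psi> is positive.
    \<open>K\<close> is compact for the approximation; \<open>U\<close> is the open domain of the
    metric.\<close>
  define K where "K = {z. infdist z (\<Union>V) \<le> \<epsilon> / 2}"
  define U where "U = {z. infdist z (\<Union>V) < \<epsilon> / 2}"
  have VS: "\<Union>V \<noteq> {}" using V by blast
  have cS: "compact (\<Union>V)" using V by (auto intro: compact_Union)
  have K: "compact K" unfolding K_def using cS VS \<epsilon> by (intro compact_infdist_le) auto
  have UK: "U \<subseteq> K" by (auto simp: U_def K_def)
  have \<rho>0: "\<rho> z B \<ge> 0" for z B by (simp add: \<rho>_def)
  have \<sigma>: "sum (\<rho> z) V > 0" if "z \<in> K" for z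
  proof -
    obtain s where s: "s \<in> \<Union>V" "infdist z (\<Union>V) = dist z s"
      using infdist_attains_inf[OF compact_imp_closed[OF cS] VS] by blast
    then obtain B where B: "B \<in> V" "s \<in> B" by blast
    then have "infdist z B \<le> \<epsilon> / 2"
      using infdist_le[OF B(2), of z] s(2) that by (simp add: K_def)
    then have "\<rho> z B > 0" using \<epsilon> by (simp add: \<rho>_def)
    then show ?thesis using B V(1) \<rho>0 by (intro sum_pos2[of V B]) auto
  qed
  have cont\<psi>: "continuous_on K \<psi>"
    unfolding \<psi>_def \<rho>_def
    by (intro continuous_intros) (use \<sigma> in \<open>force simp: \<rho>_def\<close>)
  define m where "m = Min (\<phi> ` V)"
  have m: "m > 0" using V(1,2) \<phi> by (simp add: m_def)
  have m\<psi>: "m \<le> \<psi> z" if "z \<in> K" for z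
    unfolding \<psi>_def by (rule weighted_mean_ge) (use \<rho>0 \<sigma>[OF that] V(1) in \<open>auto simp: m_def\<close>)
  define L1 where "L1 = (L + 1) / 2"
  have L1: "L1 > 1" using L by (simp add: L1_def)
  have \<psi>_exp: "L1 * \<psi> z \<le> \<psi> (f z) * cmod (f' z)" if z: "z \<in> K" "f z \<in> K" for z
  proof -
    \<comment> \<open>First average over the boxes \<open>C\<close> near \<open>f z\<close> with
      \<open>B\<close> fixed, then over the boxes \<open>B\<close> near \<open>z\<close>.\<close>
    have *: "L1 * \<phi> B \<le> \<psi> (f z) * cmod (f' z)" if B: "B \<in> V" "\<rho> z B > 0" for B
    proof -
      have "L1 * \<phi> B \<le> (\<Sum>C\<in>V. (\<phi> C * cmod (f' z)) * \<rho> (f z) C) / sum (\<rho> (f z)) V"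
      proof (rule weighted_mean_ge)
        show "L1 * \<phi> B \<le> \<phi> C * cmod (f' z)" if "C \<in> V" "\<rho> (f z) C > 0" for C
          using near[OF B(1) that(1), of z] B(2) that(2)
          by (auto simp: \<rho>_def L1_def max_def split: if_splits)
      qed (use \<rho>0 \<sigma>[OF z(2)] in auto)
      also have "\<dots> = \<psi> (f z) * cmod (f' z)"
        by (simp add: \<psi>_def sum_distrib_right sum_distrib_left mult_ac)
      finally show ?thesis .
    qed
    have "L1 * \<psi> z = (\<Sum>B\<in>V. (L1 * \<phi> B) * \<rho> z B) / sum (\<rho> z) V"
      by (simp add: \<psi>_def sum_distrib_left sum_distrib_right mult_ac)
    also have "\<dots> \<le> \<psi> (f z) * cmod (f' z)"
      by (rule weighted_mean_le) (use \<rho>0 \<sigma>[OF z(1)] * in auto)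
    finally show ?thesis .
  qed
  \<comment> \<open>The tolerated relative error: half of the threshold
    \<open>(L1 - 1) / (L1 + 1)\<close>, at which \<open>1 + t\<close> would equal
    \<open>(1 - t) * L1\<close>.\<close>
  define t where "t = (L1 - 1) / (2 * (L1 + 1))"
  have t: "0 < t" "t < 1" using L1 by (auto simp: t_def field_simps)
  have tL: "1 + t < (1 - t) * L1"
  proof -
    have "t * (L1 + 1) = (L1 - 1) / 2" using L1 by (simp add: t_def field_simps)
    then have "t * (L1 + 1) < L1 - 1" using L1 by simp
    then show ?thesis by (simp add: algebra_simps)
  qed
  \<comment> \<open>As \<psi> is at least \<open>m\<close> on \<open>K\<close>, the absolute error
    \<open>t * m\<close> is a relative error of at most \<open>t\<close>.\<close>
  obtain g where g: "real_polynomial_function g" "\<And>z. z \<in> K \<Longrightarrow> \<bar>\<psi> z - g z\<bar> < t * m"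
    using Stone_Weierstrass_real_polynomial_function[OF K cont\<psi>, of "t * m"] t m by auto
  have close: "(1 - t) * \<psi> z \<le> g z" "g z \<le> (1 + t) * \<psi> z" if "z \<in> K" for z
  proof -
    have "t * m \<le> t * \<psi> z" using m\<psi>[OF that] t by (intro mult_left_mono) auto
    with g(2)[OF that] show "(1 - t) * \<psi> z \<le> g z" "g z \<le> (1 + t) * \<psi> z"
      by (auto simp: algebra_simps)
  qed
  \<comment> \<open>The worst case: \<open>g\<close> too small by \<open>1 - t\<close> at
    \<open>f z\<close> and too large by \<open>1 + t\<close> at \<open>z\<close>.\<close>
  define \<Lambda> where "\<Lambda> = (1 - t) * L1 / (1 + t)"
  show ?thesis
  proof (rule that[of U g \<Lambda>])
    show "open U"
      unfolding U_def by (intro open_Collect_less continuous_intros)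
    show "\<Union>V \<subseteq> U" using \<epsilon> by (simp add: U_def subset_iff del: Union_iff)
    show "g z > 0" if "z \<in> U" for z
    proof -
      have "0 < (1 - t) * \<psi> z" using m\<psi>[of z] m t that UK by auto
      then show ?thesis using close(1)[of z] that UK by auto
    qed
    show "\<Lambda> > 1" using tL t by (simp add: \<Lambda>_def)
    show "g (f z) * cmod (f' z) \<ge> \<Lambda> * g z" if "z \<in> U" "f z \<in> U" for z
    proof -
      have z: "z \<in> K" "f z \<in> K" using that UK by auto
      have "\<Lambda> * g z \<le> \<Lambda> * ((1 + t) * \<psi> z)"
        using close(2)[OF z(1)] \<open>\<Lambda> > 1\<close> by (intro mult_left_mono) auto
      also have "\<dots> = (1 - t) * (L1 * \<psi> z)" using t by (simp add: \<Lambda>_def)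
      also have "\<dots> \<le> (1 - t) * (\<psi> (f z) * cmod (f' z))"
        using \<psi>_exp[OF z] t by (intro mult_left_mono) auto
      also have "\<dots> = ((1 - t) * \<psi> (f z)) * cmod (f' z)" by simp
      also have "\<dots> \<le> g (f z) * cmod (f' z)"
        using close(1)[OF z(2)] by (intro mult_right_mono) auto
      finally show ?thesis .
    qed
  qed (use g in auto)
qed

lemma hyperbolicI_conformal:
  assumes U: "open U" "julia_set f \<subseteq> U"
    and g: "real_polynomial_function g" "\<And>z. z \<in> U \<Longrightarrow> g z > 0" and "\<Lambda> > 1"
    and exp: "\<And>z v. z \<in> U \<Longrightarrow> f z \<in> U \<Longrightarrow>
      g (f z) * cmod (frechet_derivative f (at z) v) \<ge> \<Lambda> * (g z * cmod v)"
  shows "hyperbolic f"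
proof -
  \<comment> \<open>The square makes the norm scale by \<open>g\<close> itself, and for fixed
    vectors the entry is a polynomial function of \<open>z\<close>.\<close>
  define \<mu> where "\<mu> z v w = (g z)\<^sup>2 * (v \<bullet> w)" for z v w :: complex
  have norm: "riemannian_norm \<mu> z v = g z * cmod v" if "z \<in> U" for z v
    using g(2)[OF that]
    by (simp add: riemannian_norm_def \<mu>_def real_sqrt_mult norm_eq_sqrt_inner)
  have "riemannian_metric_on U \<mu>"
    unfolding riemannian_metric_on_def
  proof (intro conjI ballI allI impI)
    fix z v w :: complex assume z: "z \<in> U"
    show "bilinear (\<mu> z)"
      unfolding bilinear_def \<mu>_def
      by (auto intro!: linearI simp: inner_add_left inner_add_right algebra_simps)
    show "\<mu> z v w = \<mu> z w v" by (simp add: \<mu>_def inner_commute)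
    show "\<mu> z v v > 0" if "v \<noteq> 0" using g(2)[OF z] that by (simp add: \<mu>_def)
  next
    fix v w :: complex
    show "smooth_on (\<lambda>z. \<mu> z v w) U"
      unfolding \<mu>_def using g(1) by (intro real_polynomial_function_smooth_on) auto
  qed
  then show ?thesis
    unfolding hyperbolic_def using U norm exp \<open>\<Lambda> > 1\<close>
    by (intro exI[of _ U] exI[of _ \<mu>] exI[of _ \<Lambda>]) auto
qed

section \<open>Box chain models\<close>

lemma closed_box_cbox:
  assumes "closed_box B"
  obtains u v where "B = cbox u v" "B \<noteq> {}"
proof -
  obtain a b c d where *: "a < b" "c < d" "B = {z. Re z \<in> {a..b} \<and> Im z \<in> {c..d}}"
    using assms by (auto simp: closed_box_def)
  then have "B = cbox (Complex a c) (Complex b d)"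
    by (auto simp: in_cbox_complex_iff)
  moreover have "Complex a c \<in> B" using * by auto
  ultimately show ?thesis using that by blast
qed

lemma frechet_derivative_poly:
  "frechet_derivative (poly p) (at z) v = deriv (poly p) z * v" for p :: "complex poly"
proof -
  have "(poly p has_derivative (\<lambda>v. deriv (poly p) z * v)) (at z)"
    using poly_DERIV[of p z] by (simp add: has_field_derivative_def DERIV_imp_deriv)
  then show ?thesis by (metis frechet_derivative_at)
qed

lemma box_multiplier_le: "z \<in> B \<Longrightarrow> box_multiplier f B \<le> cmod (deriv f z)"
  unfolding box_multiplier_def by (rule cINF_lower) (auto intro: bdd_belowI2[of _ 0])

lemma box_multiplier_ge:
  "B \<noteq> {} \<Longrightarrow> (\<And>z. z \<in> B \<Longrightarrow> c \<le> cmod (deriv f z)) \<Longrightarrow> c \<le> box_multiplier f B"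
  unfolding box_multiplier_def by (rule cINF_greatest)

text \<open>The derivative is multiplication by a complex number and stretches all directions
  equally, so testing \<open>v = 1\<close> suffices. What remains is a lower bound on
  \<open>cmod (deriv (poly p) z)\<close> uniform in the box, that is, on its infimum.\<close>

lemma box_expansive_poly_iff:
  fixes p :: "complex poly"
  assumes G: "pair_wf_digraph G" and ne: "\<And>B. B \<in> pverts G \<Longrightarrow> B \<noteq> {}"
  shows "box_expansive (poly p) G \<longleftrightarrow>
    (\<exists>\<phi> L. (\<forall>B\<in>pverts G. \<phi> B > 0) \<and> L > 1 \<and>
      (\<forall>(B, C)\<in>parcs G. L * \<phi> B \<le> box_multiplier (poly p) B * \<phi> C))"
proof -
  have eq: "(\<forall>z\<in>B. \<forall>v. \<phi> C * cmod (frechet_derivative (poly p) (at z) v) \<ge> L * (\<phi> B * cmod v))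
      \<longleftrightarrow> L * \<phi> B \<le> box_multiplier (poly p) B * \<phi> C" (is "?lhs \<longleftrightarrow> ?rhs")
    if pos: "\<forall>B\<in>pverts G. \<phi> B > 0" and arc: "(B, C) \<in> parcs G"
    for \<phi> :: "complex set \<Rightarrow> real" and L B C
  proof -
    have B: "B \<noteq> {}" "\<phi> C > 0"
      using pair_wf_digraph.arc_fst_in_verts[OF G arc] pair_wf_digraph.arc_snd_in_verts[OF G arc] ne pos
      by auto
    show ?thesis
    proof
      assume l: ?lhs
      have "L * \<phi> B / \<phi> C \<le> box_multiplier (poly p) B"
      proof (rule box_multiplier_ge[OF B(1)])
        fix z assume "z \<in> B"
        with l have "\<phi> C * cmod (frechet_derivative (poly p) (at z) 1) \<ge> L * (\<phi> B * cmod 1)" by blast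
        then show "L * \<phi> B / \<phi> C \<le> cmod (deriv (poly p) z)"
          using B(2) by (simp add: frechet_derivative_poly field_simps)
      qed
      then show ?rhs using B(2) by (simp add: field_simps)
    next
      assume r: ?rhs
      show ?lhs
      proof (intro ballI allI)
        fix z v assume z: "z \<in> B"
        have "L * \<phi> B \<le> cmod (deriv (poly p) z) * \<phi> C"
          using r mult_right_mono[OF box_multiplier_le[OF z, of "poly p"], of "\<phi> C"] B(2) by linarith
        from mult_right_mono[OF this, of "cmod v"]
        show "L * (\<phi> B * cmod v) \<le> \<phi> C * cmod (frechet_derivative (poly p) (at z) v)"
          by (simp add: frechet_derivative_poly norm_mult mult_ac)
      qed
    qed
  qed
  have eq': "(\<forall>(B, C)\<in>parcs G. \<forall>z\<in>B. \<forall>v.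
        \<phi> C * cmod (frechet_derivative (poly p) (at z) v) \<ge> L * (\<phi> B * cmod v)) \<longleftrightarrow>
      (\<forall>(B, C)\<in>parcs G. L * \<phi> B \<le> box_multiplier (poly p) B * \<phi> C)"
    if "\<forall>B\<in>pverts G. \<phi> B > 0" for \<phi> :: "complex set \<Rightarrow> real" and L
  proof (intro ball_cong refl)
    fix e assume "e \<in> parcs G"
    then show "(case e of (B, C) \<Rightarrow> \<forall>z\<in>B. \<forall>v.
        \<phi> C * cmod (frechet_derivative (poly p) (at z) v) \<ge> L * (\<phi> B * cmod v)) \<longleftrightarrow>
      (case e of (B, C) \<Rightarrow> L * \<phi> B \<le> box_multiplier (poly p) B * \<phi> C)"
      using eq[OF that, of "fst e" "snd e" L] by (simp add: case_prod_beta)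
  qed
  show ?thesis
    unfolding box_expansive_def
    by (rule ex_cong1, rule ex_cong1, rule conj_cong[OF refl], rule conj_cong[OF refl], rule eq')
qed

text \<open>Strong connectivity alone admits a single vertex without a loop. A Julia point and its
  image, each lying in some box, force an arc between these boxes.\<close>

lemma box_chain_model_arcs_nonempty:
  fixes p :: "complex poly"
  assumes "degree p > 1" "box_chain_model (poly p) G"
  shows "parcs G \<noteq> {}"
proof -
  obtain \<delta> where \<delta>: "\<delta> > 0"
    "{(B, C). B \<in> pverts G \<and> C \<in> pverts G \<and> poly p ` B \<inter> nbhd C \<delta> \<noteq> {}} \<subseteq> parcs G"
    and J: "julia_set (poly p) \<subseteq> \<Union>(pverts G)"
    using assms(2) by (auto simp: box_chain_model_def)
  obtain z where z: "z \<in> julia_set (poly p)" using julia_set_poly_nonempty[OF assms(1)] by blast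
  have "poly p z \<in> julia_set (poly p)"
    by (rule julia_set_invariant[OF _ z]) (intro continuous_intros)
  then obtain B C where BC: "B \<in> pverts G" "z \<in> B" "C \<in> pverts G" "poly p z \<in> C"
    using J z by blast
  then have "poly p z \<in> poly p ` B \<inter> nbhd C \<delta>"
    using \<delta>(1) centre_in_ball[of "poly p z" \<delta>] unfolding nbhd_def by blast
  then show ?thesis using \<delta>(2) BC by blast
qed

lemma box_expansive_imp_hyperbolic:
  fixes p :: "complex poly"
  assumes model: "box_chain_model (poly p) G" and exp: "box_expansive (poly p) G"
  shows "hyperbolic (poly p)"
proof -
  have V: "finite (pverts G)" "pverts G \<noteq> {}"
    using model
    by (auto simp: box_chain_model_def strongly_connected_def pair_fin_digraph.pair_finite_verts)
  have box: "compact B \<and> B \<noteq> {}" if "B \<in> pverts G" for B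
    using model that unfolding box_chain_model_def by (metis closed_box_cbox compact_cbox)
  obtain \<delta> where \<delta>: "\<delta> > 0"
    "{(B, C). B \<in> pverts G \<and> C \<in> pverts G \<and> poly p ` B \<inter> nbhd C \<delta> \<noteq> {}} \<subseteq> parcs G"
    using model by (auto simp: box_chain_model_def)
  obtain \<phi> L where \<phi>: "\<And>B. B \<in> pverts G \<Longrightarrow> \<phi> B > 0" and L: "L > 1"
    and ex: "\<And>B C z v. (B, C) \<in> parcs G \<Longrightarrow> z \<in> B \<Longrightarrow>
      \<phi> C * cmod (frechet_derivative (poly p) (at z) v) \<ge> L * (\<phi> B * cmod v)"
    using exp unfolding box_expansive_def by fast
  have deriv: "deriv (poly p) = poly (pderiv p)" by (auto intro: DERIV_imp_deriv poly_DERIV)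
  have ex': "\<phi> C * cmod (deriv (poly p) z) \<ge> L * \<phi> B"
    if "B \<in> pverts G" "C \<in> pverts G" "poly p ` B \<inter> nbhd C \<delta> \<noteq> {}" "z \<in> B" for B C z
    using ex[of B C z 1] that \<delta>(2) by (auto simp: frechet_derivative_poly)
  have cont: "continuous_on UNIV (poly p)" "continuous_on UNIV (deriv (poly p))"
    by (auto simp: deriv intro!: continuous_intros)
  obtain U g \<Lambda> where U: "open U" "\<Union>(pverts G) \<subseteq> U"
    and g: "real_polynomial_function g" "\<And>z. z \<in> U \<Longrightarrow> g z > 0" and \<Lambda>: "\<Lambda> > 1"
    and e: "\<And>z. z \<in> U \<Longrightarrow> poly p z \<in> U \<Longrightarrow> g (poly p z) * cmod (deriv (poly p) z) \<ge> \<Lambda> * g z"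
    by (rule smooth_expanding_conformal_factor[where \<phi> = \<phi>, OF V box cont \<phi> L \<delta>(1) ex']) blast+
  show ?thesis
  proof (rule hyperbolicI_conformal[OF U(1) _ g \<Lambda>])
    show "julia_set (poly p) \<subseteq> U" using model U(2) by (auto simp: box_chain_model_def)
    fix z v assume "z \<in> U" "poly p z \<in> U"
    from mult_right_mono[OF e[OF this], of "cmod v"]
    show "\<Lambda> * (g z * cmod v) \<le> g (poly p z) * cmod (frechet_derivative (poly p) (at z) v)"
      by (simp add: frechet_derivative_poly norm_mult mult_ac)
  qed
qed

theorem corollary1p8:
  fixes p :: "complex poly" and G :: "complex set pair_pre_digraph"
  assumes "degree p > 1"
    and "box_chain_model (poly p) G"
  shows "(box_expansive (poly p) G \<longleftrightarrow> min_cycle_multiplier (poly p) G > 1) \<and>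
         (box_expansive (poly p) G \<longrightarrow> hyperbolic (poly p))"
proof (intro conjI impI)
  have fin: "pair_fin_digraph G" and sc: "strongly_connected (with_proj G)"
    using assms(2) by (auto simp: box_chain_model_def)
  have wf: "pair_wf_digraph G" using fin by (simp add: pair_fin_digraph_def)
  interpret D: fin_digraph "with_proj G"
    using fin by unfold_locales
      (auto simp: pair_wf_digraph.arc_fst_in_verts[OF wf] pair_wf_digraph.arc_snd_in_verts[OF wf]
        pair_fin_digraph.pair_finite_verts pair_fin_digraph.pair_finite_arcs)
  \<comment> \<open>Weighting each arc by the multiplier of its tail turns cycle multipliers into
    the products of the potential lemmas.\<close>
  define w where "w = (\<lambda>e :: complex set \<times> complex set. box_multiplier (poly p) (fst e))"
  define Z where "Z = cycle_multiplier (poly p) ` {c. D.cycle c}"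
  have ne: "B \<noteq> {}" if "B \<in> pverts G" for B
    using assms(2) that unfolding box_chain_model_def by (metis closed_box_cbox)
  have arcs: "parcs G \<noteq> {}" by (rule box_chain_model_arcs_nonempty[OF assms])
  have Z: "finite Z" "Z \<noteq> {}"
  proof -
    show "finite Z" unfolding Z_def using D.finite_cycles by simp
    obtain e where "e \<in> arcs (with_proj G)" using arcs by auto
    from D.strongly_connected_arc_on_cycle[OF sc this] show "Z \<noteq> {}" by (auto simp: Z_def)
  qed
  have cm: "cycle_multiplier (poly p) c = prod_list (map w c)" for c
    by (simp add: cycle_multiplier_def w_def)
  have min: "min_cycle_multiplier (poly p) G = Min Z"
    by (simp add: min_cycle_multiplier_def Z_def)
  have exp: "box_expansive (poly p) G \<longleftrightarrow> (\<exists>\<phi> L. (\<forall>B\<in>pverts G. \<phi> B > 0) \<and> L > 1 \<and>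
      (\<forall>e\<in>parcs G. L * \<phi> (fst e) \<le> w e * \<phi> (snd e)))"
    using box_expansive_poly_iff[OF wf ne] by (simp add: w_def case_prod_beta)
  show "box_expansive (poly p) G \<longleftrightarrow> min_cycle_multiplier (poly p) G > 1"
  proof
    assume "box_expansive (poly p) G"
    then obtain \<phi> L where pot: "\<And>B. B \<in> pverts G \<Longrightarrow> \<phi> B > 0" "L > 1"
      "\<And>e. e \<in> parcs G \<Longrightarrow> L * \<phi> (fst e) \<le> w e * \<phi> (snd e)"
      using exp by blast
    have "cycle_multiplier (poly p) c > 1" if c: "D.cycle c" for c
    proof -
      obtain u where u: "D.awalk u c u" "c \<noteq> []" using c by (auto simp: D.cycle_conv)
      have "\<phi> u > 0" using D.awalk_hd_in_verts[OF u(1)] pot(1) by simp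
      \<comment> \<open>The walk is closed, so the same positive handicap stands on both sides and
        cancels.\<close>
      moreover have "L ^ length c * \<phi> u \<le> prod_list (map w c) * \<phi> u"
        by (rule D.prod_list_awalk_potential[OF u(1)]) (use pot in auto)
      ultimately have "L ^ length c \<le> prod_list (map w c)" by simp
      moreover have "1 < L ^ length c" using pot(2) u(2) by (simp add: one_less_power)
      ultimately show ?thesis by (simp add: cm)
    qed
    then show "min_cycle_multiplier (poly p) G > 1" using Z by (auto simp: min Z_def)
  next
    assume M: "min_cycle_multiplier (poly p) G > 1"
    have nonneg: "w e \<ge> 0" if "e \<in> arcs (with_proj G)" for e
      unfolding w_def using that ne pair_wf_digraph.arc_fst_in_verts[OF wf] by (intro box_multiplier_ge) auto
    have "prod_list (map w c) \<ge> min_cycle_multiplier (poly p) G" if "D.cycle c" for c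
      unfolding min cm[symmetric] using Z that by (intro Min_le) (auto simp: Z_def)
    from D.expanding_potential[OF nonneg sc _ this M] arcs obtain \<phi> L where
      "\<And>v. v \<in> pverts G \<Longrightarrow> \<phi> v > 0" "L > 1"
      "\<And>e. e \<in> parcs G \<Longrightarrow> L * \<phi> (fst e) \<le> w e * \<phi> (snd e)"
      by auto
    then show "box_expansive (poly p) G" unfolding exp by blast
  qed
  show "hyperbolic (poly p)" if "box_expansive (poly p) G"
    using box_expansive_imp_hyperbolic[OF assms(2) that] .
qed

end
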